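(* Let $H$ be a Hilbert space, let $\mathcal K\subset H$ be a compact subset with $\sup_{f\in\mathcal K}\|f\|_H=1$, and let $a>0$ be a fixed constant. Then the following hold. (1) Let $\alpha>0$, $\beta\in\mathbb R$, $C>0$. If $e_n(\mathcal K)_H\ge C\,\dfrac{[\log_2n]^\beta}{n^\alpha}$ for all $n=2,3,\ldots$, then there is a constant $C''>0$, independent of $n$, such that $$d_{n-1}(\mathcal K,n^{an})_H\ge C''\,\frac{[\log_2n]^{\beta-2\alpha}}{n^\alpha},\qquad n=2,3,\ldots.$$ (2) Let $\alpha>0$, $C>0$. If $e_n(\mathcal K)_H\ge C\,\dfrac1{[\log_2n]^\alpha}$ for all $n=2,3,\ldots$, then there is a constant $C''>0$, independent of $n$, such that $$d_{n-1}(\mathcal K,n^{an})_H\ge C''\,\frac{1}{[\log_2n]^\alpha},\qquad n=2,3,\ldots.$$ (3) Let $0<\alpha<1$, $C,c>0$. If $e_n(\mathcal K)_H\ge C\,2^{-cn^\alpha}$ for all $n=1,2,\ldots$, then there are constants $C'',c''>0$, independent of $n$, such that $$d_{n-1}(\mathcal K,n^{an})_H\ge C''\,2^{-c''[n\log_2n]^{\alpha/(1-\alpha)}},\qquad n=2,3,\ldots.$$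
   Context: All linear spaces are over the real numbers. For a compact set $\mathcal K$ in a normed space $X$ the entropy numbers are $$e_n(\mathcal K)_X=\inf\Big\{\epsilon>0:\ \mathcal K\subset\bigcup_{j=1}^{2^n}B(g_j,\epsilon)\ \text{for some } g_1,\ldots,g_{2^n}\in X\Big\},\quad n\ge 0,$$ where $B(g,\epsilon)=\{f\in X:\|f-g\|_X\le\epsilon\}$. For real $N\ge1$ the nonlinear Kolmogorov $(n,N)$-width is $$d_0(\mathcal K,N)_X=\sup_{f\in\mathcal K}\|f\|_X,\qquad d_n(\mathcal K,N)_X=\inf_{\mathcal L_N}\ \sup_{f\in\mathcal K}\ \inf_{X_n\in\mathcal L_N}\operatorname{dist}(f,X_n)_X,\quad n\ge1,$$ where the outer infimum is over all sets $\mathcal L_N$ of at most $N$ linear subspaces $X_n\subset X$ of dimension $n$. The constants $C'',c''$ may depend on $\mathcal K,a,\alpha,\beta,C,c$. *)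

theory Defs
  imports "HOL-Analysis.Analysis"
begin

text \<open>The infimum is that of the reals: for bounded (in particular compact) \<open>K\<close> it ranges over a
  nonempty set bounded below by 0. Centres may repeat and need not lie in \<open>K\<close>.\<close>

definition entropy_number :: "nat \<Rightarrow> 'a::real_normed_vector set \<Rightarrow> real" where
  "entropy_number n K =
     Inf {\<epsilon>. \<epsilon> > 0 \<and> (\<exists>g :: nat \<Rightarrow> 'a. K \<subseteq> (\<Union>j\<in>{1..2 ^ n}. cball (g j) \<epsilon>))}"

text \<open>Widths are extended reals, so that an infimum over an empty family is \<open>\<infinity>\<close>; this covers the
  empty collection \<open>L\<close> and spaces without \<open>n\<close>-dimensional subspaces. As \<open>n \<ge> 1\<close> in the second
  branch, \<open>dim V = n\<close> excludes infinite-dimensional \<open>V\<close>, for which \<open>dim\<close> is 0.\<close>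

definition kolmogorov_width :: "nat \<Rightarrow> 'a::real_normed_vector set \<Rightarrow> real \<Rightarrow> ereal" where
  "kolmogorov_width n K N =
     (if n = 0 then (SUP f\<in>K. ereal (norm f))
      else (INF L\<in>{L :: 'a set set. finite L \<and> real (card L) \<le> N \<and>
                       (\<forall>V\<in>L. subspace V \<and> dim V = n)}.
              SUP f\<in>K. INF V\<in>L. ereal (infdist f V)))"

end

theory Submission imports Defs "HOL-Real_Asymp.Real_Asymp" begin

text \<open>
  If a set \<open>K\<close> in the unit ball has small nonlinear width, it has small entropy numbers. Suppose that
  every point of \<open>K\<close> is within \<open>\<delta> \<le> 1\<close> of one of at most \<open>N\<close> subspaces of dimension \<open>k\<close>. The
  approximants have norm at most 2, and the ball of radius 2 in a \<open>k\<close>-dimensional inner product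
  space has a \<open>\<delta>\<close>-net of at most \<open>(8 k / \<delta>)\<^sup>k\<close> points; so \<open>N (8 k / \<delta>)\<^sup>k\<close> balls of radius \<open>2 \<delta>\<close>
  cover \<open>K\<close> (\<open>entropy_number_le_of_width\<close>). A coordinate grid serves as the net. It has about
  \<open>k\<^sup>k\<close> times as many points as an optimal one, but the number of subspaces, \<open>N = n\<^sup>a\<^sup>n\<close>, is of that
  order anyway.

  For \<open>k = n - 1\<close> and \<open>N = n\<^sup>a\<^sup>n\<close> the logarithm of the number of balls is at most
  \<open>(a + 4) n log n + n log (1 / \<delta>)\<close>. Read contrapositively: if \<open>m\<close> is at least this quantity and the
  \<open>m\<close>-th entropy number exceeds \<open>2 \<delta>\<close>, then the width is at least \<open>\<delta>\<close>
  (\<open>width_ge_of_entropy_number\<close>). What is left is to choose \<open>\<delta>\<close> for each rate of decay.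

  For entropy numbers of order at least \<open>(log n)\<^sup>\<beta> / n\<^sup>\<alpha>\<close> with \<open>\<alpha> \<ge> 0\<close>, take \<open>\<delta>\<close> to be a small multiple of
  \<open>(log n)\<close> to the power \<open>\<beta> - \<alpha>\<close>, divided by \<open>n\<^sup>\<alpha>\<close>. Then \<open>log (1 / \<delta>)\<close> is of order \<open>log n\<close>, so \<open>m\<close>
  is of order \<open>n log n\<close> and the two sides match (\<open>width_ge_polynomial\<close>). The first claim follows
  because \<open>log n \<ge> 1\<close>, and the second is the case of exponents \<open>0\<close> and \<open>- \<alpha>\<close>.

  For entropy numbers of order at least \<open>2\<close> to the power \<open>- c n\<^sup>\<alpha>\<close>, put \<open>x = n log n\<close> and let \<open>y\<close> be
  \<open>x\<close> to the power \<open>\<alpha> / (1 - \<alpha>)\<close>. With \<open>log (1 / \<delta>)\<close> of order \<open>d y\<close> one needs \<open>m\<close> of order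
  \<open>(1 + d) x y\<close>, and the exponent is chosen so that \<open>(x y)\<^sup>\<alpha> = y\<close>. The comparison then comes down to
  \<open>c (A + d)\<^sup>\<alpha> \<le> d\<close>, which holds for large \<open>d\<close> as \<open>\<alpha> < 1\<close> (\<open>width_ge_exponential\<close>).
\<close>

section \<open>Nets in balls of finite-dimensional subspaces\<close>

lemma entropy_number_le:
  assumes "finite G" "card G \<le> 2 ^ m" "\<epsilon> > 0" "K \<subseteq> (\<Union>x\<in>G. cball x \<epsilon>)"
  shows "entropy_number m K \<le> \<epsilon>"
proof -
  obtain h where h: "bij_betw h {1..card G} G"
    using ex_bij_betw_nat_finite_1[OF assms(1)] by blast
  have "K \<subseteq> (\<Union>j\<in>{1..2 ^ m}. cball (h j) \<epsilon>)"
  proof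
    fix f assume "f \<in> K"
    then obtain x where x: "x \<in> G" "f \<in> cball x \<epsilon>" using assms(4) by blast
    then obtain j where j: "j \<in> {1..card G}" "h j = x"
      using h by (metis bij_betw_imp_surj_on imageE)
    then have "j \<in> {1..2 ^ m}" using assms(2) by simp
    then show "f \<in> (\<Union>j\<in>{1..2 ^ m}. cball (h j) \<epsilon>)"
      using x(2)[folded j(2)] by (rule UN_I)
  qed
  then have "\<epsilon> \<in> {\<epsilon>. \<epsilon> > 0 \<and> (\<exists>g :: nat \<Rightarrow> 'a. K \<subseteq> (\<Union>j\<in>{1..2 ^ m}. cball (g j) \<epsilon>))}"
    using assms(3) by blast
  then show ?thesis
    unfolding entropy_number_def by (rule cInf_lower) (rule bdd_belowI[of _ 0], simp)
qed

text \<open>Orthogonalising a basis yields an orthogonal spanning set that may contain 0. Writing \<open>sgn c\<close> for the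
  normalised vectors allows for this, since \<open>sgn 0 = 0\<close>.\<close>

lemma orthogonal_expansion:
  fixes C :: "'a::real_inner set"
  assumes fin: "finite C" and orth: "pairwise orthogonal C" and g: "g \<in> span C"
  shows "(\<Sum>c\<in>C. (g \<bullet> sgn c) *\<^sub>R sgn c) = g"
proof -
  define r where "r = g - (\<Sum>c\<in>C. (g \<bullet> sgn c) *\<^sub>R sgn c)"
  have "r \<in> span C"
    unfolding r_def sgn_div_norm by (intro span_diff g span_sum span_scale span_base)
  have "orthogonal r d" if d: "d \<in> C" for d
  proof -
    have "(\<Sum>c\<in>C. (g \<bullet> sgn c) *\<^sub>R sgn c) \<bullet> d = (\<Sum>c\<in>C. (g \<bullet> sgn c) * (sgn c \<bullet> d))"
      by (simp add: inner_sum_left)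
    also have "\<dots> = (\<Sum>c\<in>C. if c = d then g \<bullet> d else 0)"
    proof (rule sum.cong)
      fix c assume c: "c \<in> C"
      show "(g \<bullet> sgn c) * (sgn c \<bullet> d) = (if c = d then g \<bullet> d else 0)"
      proof (cases "c = d")
        case True
        then show ?thesis
          by (cases "d = 0") (simp_all add: sgn_div_norm dot_square_norm power2_eq_square field_simps)
      next
        case False
        then have "c \<bullet> d = 0" using orth c d by (simp add: pairwise_def orthogonal_def)
        then show ?thesis using False by (simp add: sgn_div_norm)
      qed
    qed simp
    also have "\<dots> = g \<bullet> d" using fin d by simp
    finally show ?thesis by (simp add: r_def orthogonal_def inner_diff_left)
  qed
  then have "orthogonal r r" using orthogonal_to_span \<open>r \<in> span C\<close> by blast
  then show ?thesis by (simp add: r_def orthogonal_self)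
qed

text \<open>Round each of the at most \<open>k\<close> orthonormal coordinates down to a multiple of \<open>\<epsilon> / k\<close>. By the
  triangle inequality the total error is at most \<open>\<epsilon>\<close>, and each coordinate, being bounded by \<open>R\<close>, takes
  at most \<open>2 R k / \<epsilon> + 3\<close> rounded values.\<close>

lemma finite_net_subspace_ball:
  fixes V :: "'a::real_inner set"
  assumes V: "subspace V" "dim V = k" "k > 0" and R: "R \<ge> 0" and \<epsilon>: "\<epsilon> > 0"
  obtains G where "finite G" "real (card G) \<le> (2 * R * k / \<epsilon> + 3) ^ k"
    "\<And>g. g \<in> V \<Longrightarrow> norm g \<le> R \<Longrightarrow> \<exists>x\<in>G. dist g x \<le> \<epsilon>"
proof -
  obtain B where B: "V \<subseteq> span B" "card B = k"
    using basis_exists[of V] V(2) by metis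
  then have "finite B" using V(3) card_gt_0_iff by blast
  then obtain C where C: "finite C" "card C \<le> k" "span C = span B" "pairwise orthogonal C"
    using basis_orthogonal[of B] B(2) by auto
  define h where "h = \<epsilon> / k"
  define p where "p = \<lceil>R / h\<rceil>"
  have h: "h > 0" using \<epsilon> V(3) by (simp add: h_def)
  have "R / h \<ge> 0" using R h by simp
  then have p: "p \<ge> 0" by (simp add: p_def)
  define G where "G = (\<lambda>q. \<Sum>c\<in>C. (h * real_of_int (q c)) *\<^sub>R sgn c) ` (C \<rightarrow>\<^sub>E {-p..p})"
  have fin: "finite (C \<rightarrow>\<^sub>E {-p..p})" using C(1) by (intro finite_PiE) auto
  have "card G \<le> card (C \<rightarrow>\<^sub>E {-p..p})" unfolding G_def by (rule card_image_le[OF fin])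
  also have "\<dots> = nat (2 * p + 1) ^ card C"
    using C(1) by (simp add: card_PiE algebra_simps)
  also have "\<dots> \<le> nat (2 * p + 1) ^ k" using C(2) p by (intro power_increasing) auto
  finally have "real (card G) \<le> real (nat (2 * p + 1) ^ k)" by linarith
  also have "\<dots> = (2 * real_of_int p + 1) ^ k" using p by simp
  also have "\<dots> \<le> (2 * R * k / \<epsilon> + 3) ^ k"
  proof (rule power_mono)
    have "real_of_int p \<le> R / h + 1" by (simp add: p_def)
    also have "R / h = R * k / \<epsilon>" by (simp add: h_def)
    finally show "2 * real_of_int p + 1 \<le> 2 * R * k / \<epsilon> + 3" by simp
  qed (use p in auto)
  finally have card: "real (card G) \<le> (2 * R * k / \<epsilon> + 3) ^ k" .
  have "\<exists>x\<in>G. dist g x \<le> \<epsilon>" if g: "g \<in> V" "norm g \<le> R" for g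
  proof -
    define q where "q = restrict (\<lambda>c. \<lfloor>(g \<bullet> sgn c) / h\<rfloor>) C"
    define x where "x = (\<Sum>c\<in>C. (h * real_of_int (q c)) *\<^sub>R sgn c)"
    have "q c \<in> {-p..p}" if "c \<in> C" for c
    proof -
      have "\<bar>g \<bullet> sgn c\<bar> \<le> norm g * norm (sgn c)" by (rule Cauchy_Schwarz_ineq2)
      also have "\<dots> \<le> R * 1" using g R by (intro mult_mono) (auto simp: norm_sgn)
      finally have "\<bar>(g \<bullet> sgn c) / h\<bar> \<le> R / h" using h by (simp add: divide_right_mono)
      then have "- (R / h) \<le> (g \<bullet> sgn c) / h" "(g \<bullet> sgn c) / h \<le> R / h" by linarith+
      moreover have "R / h \<le> real_of_int p" by (simp add: p_def)
      ultimately have "real_of_int (-p) \<le> (g \<bullet> sgn c) / h" "(g \<bullet> sgn c) / h \<le> real_of_int p"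
        by linarith+
      then have "- p \<le> \<lfloor>(g \<bullet> sgn c) / h\<rfloor>" "\<lfloor>(g \<bullet> sgn c) / h\<rfloor> \<le> p"
        using floor_mono[of "(g \<bullet> sgn c) / h" "real_of_int p"]
        by (simp_all only: le_floor_iff floor_of_int)
      then show ?thesis using that by (simp add: q_def)
    qed
    then have "x \<in> G" unfolding G_def x_def by (intro imageI) (auto simp: q_def)
    have "g \<in> span C" using g B C by auto
    then have "g - x = (\<Sum>c\<in>C. (g \<bullet> sgn c - h * real_of_int (q c)) *\<^sub>R sgn c)"
      using orthogonal_expansion[OF C(1,4)]
      by (simp add: x_def scaleR_diff_left sum_subtractf)
    also have "norm \<dots> \<le> (\<Sum>c\<in>C. h)"
    proof (rule sum_norm_le)
      fix c assume c: "c \<in> C"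
      have "real_of_int (q c) \<le> (g \<bullet> sgn c) / h" "(g \<bullet> sgn c) / h \<le> real_of_int (q c) + 1"
        using c by (simp_all add: q_def)
      then have "\<bar>g \<bullet> sgn c - h * real_of_int (q c)\<bar> \<le> h"
        using h by (simp add: field_simps)
      then have "\<bar>g \<bullet> sgn c - h * real_of_int (q c)\<bar> * norm (sgn c) \<le> h * 1"
        using h by (intro mult_mono) (auto simp: norm_sgn)
      then show "norm ((g \<bullet> sgn c - h * real_of_int (q c)) *\<^sub>R sgn c) \<le> h" by simp
    qed
    also have "\<dots> \<le> real k * h" using C(2) h by (simp add: mult_right_mono)
    also have "\<dots> = \<epsilon>" using V(3) by (simp add: h_def)
    finally have "dist g x \<le> \<epsilon>" by (simp add: dist_norm)
    with \<open>x \<in> G\<close> show ?thesis by blast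
  qed
  then show thesis using that[of G] card fin by (simp add: G_def)
qed

section \<open>Entropy numbers are controlled by widths\<close>

lemma entropy_number_le_of_width:
  fixes K :: "'a::real_inner set"
  assumes K: "\<forall>f\<in>K. norm f \<le> 1" and k: "k > 0" and \<delta>: "0 < \<delta>" "\<delta> \<le> 1"
    and width: "kolmogorov_width k K N < ereal \<delta>" and N: "N \<ge> 0"
    and m: "N * (8 * real k / \<delta>) ^ k \<le> 2 ^ m"
  shows "entropy_number m K \<le> 2 * \<delta>"
proof -
  obtain L where L: "finite L" "real (card L) \<le> N" "\<And>V. V \<in> L \<Longrightarrow> subspace V \<and> dim V = k"
    and sup: "(SUP f\<in>K. INF V\<in>L. ereal (infdist f V)) < ereal \<delta>"
    using width k by (auto simp: kolmogorov_width_def INF_less_iff)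
  have near: "\<exists>V\<in>L. \<exists>g\<in>V. dist f g < \<delta>" if "f \<in> K" for f
  proof -
    have "(INF V\<in>L. ereal (infdist f V)) < ereal \<delta>"
      by (rule le_less_trans[OF SUP_upper[OF that] sup])
    then obtain V where V: "V \<in> L" "infdist f V < \<delta>" by (auto simp: INF_less_iff)
    then have ne: "V \<noteq> {}" using L(3) subspace_0 by blast
    have "\<exists>g\<in>V. dist f g < \<delta>"
    proof (rule ccontr)
      assume "\<not> ?thesis"
      then have "\<delta> \<le> (INF g\<in>V. dist f g)" by (intro cINF_greatest ne) (simp add: not_less)
      then show False using V(2) ne by (simp add: infdist_def)
    qed
    then show ?thesis using V(1) by blast
  qed
  have "\<exists>G. finite G \<and> real (card G) \<le> (8 * real k / \<delta>) ^ k \<and>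
          (\<forall>g\<in>V. norm g \<le> 2 \<longrightarrow> (\<exists>x\<in>G. dist g x \<le> \<delta>))" if V: "V \<in> L" for V
  proof -
    obtain G where G: "finite G" "real (card G) \<le> (2 * 2 * real k / \<delta> + 3) ^ k"
      "\<And>g. g \<in> V \<Longrightarrow> norm g \<le> 2 \<Longrightarrow> \<exists>x\<in>G. dist g x \<le> \<delta>"
      using finite_net_subspace_ball[of V k 2 \<delta>] L(3)[OF V] k \<delta> by auto
    note G(2)
    also have "(2 * 2 * real k / \<delta> + 3) ^ k \<le> (8 * real k / \<delta>) ^ k"
    proof (rule power_mono)
      have "\<delta> \<le> real k" using k \<delta> by linarith
      then show "2 * 2 * real k / \<delta> + 3 \<le> 8 * real k / \<delta>" using \<delta> by (simp add: field_simps)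
    qed (use \<delta> in simp)
    finally show ?thesis using G(1,3) by blast
  qed
  then obtain G where G: "\<And>V. V \<in> L \<Longrightarrow> finite (G V)"
      "\<And>V. V \<in> L \<Longrightarrow> real (card (G V)) \<le> (8 * real k / \<delta>) ^ k"
      "\<And>V g. V \<in> L \<Longrightarrow> g \<in> V \<Longrightarrow> norm g \<le> 2 \<Longrightarrow> \<exists>x\<in>G V. dist g x \<le> \<delta>"
    by metis
  have "real (card (\<Union>(G ` L))) \<le> (\<Sum>V\<in>L. real (card (G V)))"
    using card_UN_le[OF L(1), of G] by (metis of_nat_le_iff of_nat_sum)
  also have "\<dots> \<le> real (card L) * (8 * real k / \<delta>) ^ k" by (rule sum_bounded_above) (rule G(2))
  also have "\<dots> \<le> N * (8 * real k / \<delta>) ^ k" using L(2) \<delta> by (intro mult_right_mono) auto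
  also have "\<dots> \<le> 2 ^ m" by (rule m)
  finally have "real (card (\<Union>(G ` L))) \<le> real (2 ^ m)" by simp
  then have card: "card (\<Union>(G ` L)) \<le> 2 ^ m" by (simp only: of_nat_le_iff)
  have cover: "K \<subseteq> (\<Union>x\<in>\<Union>(G ` L). cball x (2 * \<delta>))"
  proof
    fix f assume f: "f \<in> K"
    then obtain V g where V: "V \<in> L" "g \<in> V" "dist f g < \<delta>" using near by blast
    have "norm g \<le> norm f + dist f g" by (metis dist_norm dist_commute norm_triangle_sub)
    then have "norm g \<le> 2" using bspec[OF K f] V(3) \<delta> by linarith
    then obtain x where x: "x \<in> G V" "dist g x \<le> \<delta>" using G(3) V by blast
    have "dist f x \<le> 2 * \<delta>" using dist_triangle[of f x g] V(3) x(2) by linarith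
    then have "f \<in> cball x (2 * \<delta>)" by (simp add: dist_commute)
    then show "f \<in> (\<Union>x\<in>\<Union>(G ` L). cball x (2 * \<delta>))" using V(1) x(1) by blast
  qed
  show ?thesis
    by (rule entropy_number_le[OF _ card _ cover]) (use L(1) G(1) \<delta> in auto)
qed

text \<open>The contrapositive of \<open>entropy_number_le_of_width\<close>, with the number of balls written as a power
  of 2. A single unit ball covers \<open>K\<close>, so its entropy numbers are at most 1, which forces \<open>\<delta> \<le> 1\<close>.\<close>

lemma width_ge_of_entropy_number:
  fixes K :: "'a::real_inner set"
  assumes K: "\<forall>f\<in>K. norm f \<le> 1" and n: "n \<ge> 2" and \<delta>: "0 < \<delta>"
    and m: "(a + 4) * (n * log 2 n) + n * log 2 (1 / \<delta>) \<le> real m"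
    and e: "2 * \<delta> < entropy_number m K"
  shows "kolmogorov_width (n - 1) K (n powr (a * n)) \<ge> ereal \<delta>"
proof (rule ccontr)
  assume "\<not> ?thesis"
  then have w: "kolmogorov_width (n - 1) K (n powr (a * n)) < ereal \<delta>" by simp
  have "entropy_number m K \<le> 1"
    by (rule entropy_number_le[of "{0}"]) (use K in \<open>auto\<close>)
  then have \<delta>1: "\<delta> \<le> 1" using e by linarith
  have L: "log 2 n \<ge> 1" using n by (simp add: le_log_iff)
  define s where "s = 3 + log 2 n + log 2 (1 / \<delta>)"
  have s: "8 * real n / \<delta> = 2 powr s"
    using n \<delta> by (simp add: s_def powr_add powr_minus log_divide powr_diff)
  have N: "n powr (a * n) = 2 powr (a * (n * log 2 n))"
  proof -
    have "real n = 2 powr log 2 n" using n by simp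
    then have "n powr (a * n) = (2 powr log 2 n) powr (a * n)" by metis
    then show ?thesis by (simp add: powr_powr mult_ac)
  qed
  have "(8 * real (n - 1) / \<delta>) ^ (n - 1) \<le> (8 * real n / \<delta>) ^ (n - 1)"
    using \<delta> by (intro power_mono divide_right_mono) auto
  also have "\<dots> \<le> (8 * real n / \<delta>) ^ n"
    by (intro power_increasing) (use \<delta> \<delta>1 n in \<open>auto simp: field_simps\<close>)
  also have "\<dots> = 2 powr (n * s)"
    unfolding s by (simp add: powr_powr powr_realpow[symmetric] mult.commute)
  finally have "n powr (a * n) * (8 * real (n - 1) / \<delta>) ^ (n - 1)
      \<le> 2 powr (a * (n * log 2 n)) * 2 powr (n * s)" unfolding N by (intro mult_left_mono) auto
  also have "\<dots> = 2 powr (a * (n * log 2 n) + n * s)" by (simp add: powr_add)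
  also have "\<dots> \<le> 2 powr real m"
  proof (rule powr_mono)
    have "real n * 1 \<le> real n * log 2 n" using L by (intro mult_left_mono) auto
    then show "a * (n * log 2 n) + n * s \<le> real m" using m by (simp add: s_def algebra_simps)
  qed simp
  also have "\<dots> = 2 ^ m" by (simp add: powr_realpow)
  finally have "entropy_number m K \<le> 2 * \<delta>"
    by (intro entropy_number_le_of_width[OF K _ \<delta> \<delta>1 w]) (use n in auto)
  then show False using e by linarith
qed

section \<open>Rates of decay\<close>

lemma log2_le_self:
  fixes y :: real
  assumes "y > 0"
  shows "log 2 y \<le> y"
proof -
  have "ln y \<le> y / 2 - 1 + ln 2"
    using ln_le_minus_one[of "y / 2"] assms by (simp add: ln_div)
  also have "\<dots> \<le> y / 2" using ln_2_less_1 by simp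
  also have "\<dots> \<le> y * ln 2" using ln2_ge_two_thirds assms by simp
  finally show ?thesis by (simp add: log_def field_simps)
qed

text \<open>The constant \<open>D\<close> occurs twice: in \<open>\<delta>\<close> and, through \<open>log (1 / \<delta>)\<close>, in the ratio \<open>A D\<close> of \<open>m\<close>
  to \<open>n log n\<close>. This ratio costs a power of \<open>A D\<close> in the lower bound on the entropy number. As
  \<open>A D\<close> grows only logarithmically when \<open>D\<close> tends to 0, a small \<open>D\<close> wins.\<close>

lemma width_ge_polynomial:
  fixes K :: "'a::real_inner set"
  assumes K: "\<forall>f\<in>K. norm f \<le> 1" and a: "a > 0" and \<alpha>: "\<alpha> \<ge> 0" and C: "C > 0"
    and e: "\<forall>n\<ge>2. entropy_number n K \<ge> C * (log 2 (real n) powr \<beta> / real n powr \<alpha>)"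
  shows "\<exists>D>0. \<forall>n\<ge>2. kolmogorov_width (n - 1) K (real n powr (a * real n))
           \<ge> ereal (D * (log 2 (real n) powr (\<beta> - \<alpha>) / real n powr \<alpha>))"
proof -
  define \<gamma> where "\<gamma> = a + 5 + \<alpha> + \<bar>\<beta> - \<alpha>\<bar>"
  define A where "A D = \<gamma> + log 2 (1 / D)" for D :: real
  \<comment> \<open>The powers of \<open>A D\<close> lost to \<open>(log m)\<^sup>\<beta>\<close> and to \<open>m\<^sup>\<alpha>\<close>; adding 1 keeps \<open>p\<close> positive.\<close>
  define p where "p = \<bar>\<beta>\<bar> + \<alpha> + 1"
  have p: "p > 0" using \<alpha> by (simp add: p_def)
  have "((\<lambda>D. D * (2 * (\<gamma> + log 2 (1 / D))) powr p) \<longlongrightarrow> 0) (at_right 0)"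
    using p by real_asymp
  then have "\<forall>\<^sub>F D in at_right 0. D * (2 * A D) powr p < C / 2"
    unfolding A_def using C by (intro order_tendstoD) auto
  moreover have "\<forall>\<^sub>F D in at_right (0::real). 0 < D \<and> D < 1"
    by (auto simp: eventually_at_right_field intro!: exI[of _ 1])
  ultimately have "\<forall>\<^sub>F D in at_right 0. D * (2 * A D) powr p < C / 2 \<and> 0 < D \<and> D < 1"
    by (rule eventually_conj)
  then obtain D where D: "D * (2 * A D) powr p < C / 2" "0 < D" "D < 1"
    using eventually_happens[of _ "at_right (0::real)"] by auto
  have lD: "log 2 (1 / D) \<ge> 0" using D by (simp add: log_divide)
  then have A: "A D \<ge> 5" using a \<alpha> by (simp add: A_def \<gamma>_def)
  show ?thesis
  proof (intro exI[of _ D] conjI allI impI D(2))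
    fix n :: nat assume n: "n \<ge> 2"
    define L where "L = log 2 n"
    define x where "x = n * L"
    define \<delta> where "\<delta> = D * (L powr (\<beta> - \<alpha>) / n powr \<alpha>)"
    define m where "m = nat \<lfloor>A D * x\<rfloor>"
    have L: "L \<ge> 1" using n by (simp add: L_def le_log_iff)
    have LL: "0 \<le> log 2 L" "log 2 L \<le> L"
      using L log2_le_self by simp_all
    have x: "n \<le> x" using L n by (simp add: x_def)
    have \<delta>: "\<delta> > 0" using D L n by (simp add: \<delta>_def)
    have Ax: "A D * x \<ge> 5 * x" using A x n by (intro mult_right_mono) auto
    then have "A D * x \<ge> 0" using x n by simp
    then have mx: "real m \<le> A D * x" "A D * x - 1 \<le> m" by (simp_all add: m_def)
    then have xm: "x \<le> m" using Ax x n by linarith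
    have "log 2 (1 / \<delta>) = log 2 (1 / D) + \<alpha> * L - (\<beta> - \<alpha>) * log 2 L"
      using D L n by (simp add: \<delta>_def log_divide log_mult log_powr flip: L_def)
    also have "\<dots> \<le> log 2 (1 / D) * L + \<alpha> * L + \<bar>\<beta> - \<alpha>\<bar> * L"
    proof -
      have "(- (\<beta> - \<alpha>)) * log 2 L \<le> \<bar>\<beta> - \<alpha>\<bar> * L" using LL by (intro mult_mono) auto
      then have "- ((\<beta> - \<alpha>) * log 2 L) \<le> \<bar>\<beta> - \<alpha>\<bar> * L" by (simp only: mult_minus_left)
      moreover have "log 2 (1 / D) * 1 \<le> log 2 (1 / D) * L"
        using D L by (intro mult_left_mono) (auto simp: log_divide)
      ultimately show ?thesis by linarith
    qed
    finally have "n * log 2 (1 / \<delta>) \<le> n * ((log 2 (1 / D) + \<alpha> + \<bar>\<beta> - \<alpha>\<bar>) * L)"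
      by (intro mult_left_mono) (auto simp: algebra_simps)
    also have "\<dots> \<le> A D * x - (a + 5) * x"
      by (simp add: x_def A_def \<gamma>_def algebra_simps)
    finally have "(a + 4) * x + n * log 2 (1 / \<delta>) \<le> A D * x - x"
      by (simp add: algebra_simps)
    also have "\<dots> \<le> m" using mx(2) x n by linarith
    finally have req: "(a + 4) * (n * log 2 n) + n * log 2 (1 / \<delta>) \<le> real m"
      by (simp add: x_def L_def)
    have m2: "m \<ge> 2" using xm x n by linarith
    have "log 2 m \<le> log 2 (A D * x)" using mx m2 by simp
    also have "\<dots> = log 2 (A D) + (L + log 2 L)"
      using A n L by (simp add: x_def log_mult flip: L_def)
    also have "\<dots> \<le> A D * L + (L + L)"
    proof -
      have "log 2 (A D) \<le> A D" using A by (intro log2_le_self) simp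
      also have "\<dots> \<le> A D * L" using A L by simp
      finally show ?thesis using LL by linarith
    qed
    also have "\<dots> \<le> 2 * A D * L" using A L mult_right_mono[of 2 "A D" L] by simp
    finally have logm: "log 2 m \<le> 2 * A D * L" .
    have "n \<le> m" using xm x by linarith
    then have logm': "L \<le> log 2 m" using n by (simp add: L_def)
    \<comment> \<open>The upper bound on \<open>log 2 m\<close> is used for negative \<open>\<beta>\<close>, the lower one for the other \<open>\<beta>\<close>.\<close>
    have beta: "log 2 m powr \<beta> \<ge> L powr \<beta> * (2 * A D) powr (-\<bar>\<beta>\<bar>)"
    proof (cases "\<beta> \<ge> 0")
      case True
      have "L powr \<beta> * (2 * A D) powr (-\<bar>\<beta>\<bar>) \<le> L powr \<beta> * (2 * A D) powr 0"
        using A by (intro mult_left_mono powr_mono) auto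
      also have "\<dots> = L powr \<beta>" using A by simp
      also have "\<dots> \<le> log 2 m powr \<beta>" using logm' True L by (intro powr_mono2) auto
      finally show ?thesis .
    next
      case False
      then have "log 2 m powr \<beta> \<ge> (2 * A D * L) powr \<beta>"
        using logm logm' L by (intro powr_mono2') auto
      then show ?thesis using False A L by (simp add: powr_mult mult_ac)
    qed
    have "m powr \<alpha> \<le> (2 * A D * x) powr \<alpha>"
      using mx A x n \<alpha> by (intro powr_mono2) auto
    also have "\<dots> = (2 * A D) powr \<alpha> * n powr \<alpha> * L powr \<alpha>"
      using A L by (simp add: x_def powr_mult)
    finally have malpha: "m powr \<alpha> \<le> (2 * A D) powr \<alpha> * n powr \<alpha> * L powr \<alpha>" .
    have "2 * D * (2 * A D) powr (\<bar>\<beta>\<bar> + \<alpha>) \<le> 2 * D * (2 * A D) powr p"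
      using A D by (intro mult_left_mono powr_mono) (auto simp: p_def)
    also have "\<dots> < C" using D by simp
    finally have DC: "2 * D < C / (2 * A D) powr (\<bar>\<beta>\<bar> + \<alpha>)"
      using A by (simp add: pos_less_divide_eq)
    have "2 * \<delta> = 2 * D * (L powr (\<beta> - \<alpha>) / n powr \<alpha>)" by (simp add: \<delta>_def)
    also have "\<dots> < C / (2 * A D) powr (\<bar>\<beta>\<bar> + \<alpha>) * (L powr (\<beta> - \<alpha>) / n powr \<alpha>)"
      using L n by (intro mult_strict_right_mono DC) auto
    also have "\<dots> = C * ((L powr \<beta> * (2 * A D) powr (-\<bar>\<beta>\<bar>)) /
                    ((2 * A D) powr \<alpha> * n powr \<alpha> * L powr \<alpha>))"
      by (simp add: powr_minus_divide powr_add powr_diff)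
    also have "\<dots> \<le> C * (log 2 m powr \<beta> / m powr \<alpha>)"
      using C m2 beta malpha by (intro mult_left_mono frac_le) auto
    also have "\<dots> \<le> entropy_number m K" using e m2 by simp
    finally have "2 * \<delta> < entropy_number m K" .
    from width_ge_of_entropy_number[OF K n \<delta> req this]
    show "kolmogorov_width (n - 1) K (real n powr (a * real n))
           \<ge> ereal (D * (log 2 (real n) powr (\<beta> - \<alpha>) / real n powr \<alpha>))"
      by (simp add: \<delta>_def L_def)
  qed
qed

text \<open>The factor \<open>D\<close> is fixed first, so that the final comparison concerns only the exponents and
  amounts to \<open>c (A + d)\<^sup>\<alpha> \<le> d\<close>.\<close>

lemma width_ge_exponential:
  fixes K :: "'a::real_inner set"
  assumes K: "\<forall>f\<in>K. norm f \<le> 1" and a: "a > 0" and \<alpha>: "0 < \<alpha>" "\<alpha> < 1"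
    and C: "C > 0" and c: "c > 0"
    and e: "\<forall>n\<ge>1. entropy_number n K \<ge> C * 2 powr (- (c * real n powr \<alpha>))"
  shows "\<exists>D>0. \<exists>d>0. \<forall>n\<ge>2. kolmogorov_width (n - 1) K (real n powr (a * real n))
           \<ge> ereal (D * 2 powr (- (d * (real n * log 2 (real n)) powr (\<alpha> / (1 - \<alpha>)))))"
proof -
  define D where "D = min 1 C / 4"
  have D: "D > 0" "D < 1" "2 * D < C" using C by (auto simp: D_def)
  define A where "A = a + 5 + log 2 (1 / D)"
  have lD: "log 2 (1 / D) \<ge> 0" using D by (simp add: log_divide)
  have A: "A \<ge> 5" using lD a by (simp add: A_def)
  have "\<forall>\<^sub>F t in at_top. c * (A + t) powr \<alpha> \<le> t"
    using \<alpha> c by real_asymp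
  then have "\<forall>\<^sub>F t in at_top. c * (A + t) powr \<alpha> \<le> t \<and> t > 0"
    by (intro eventually_conj eventually_gt_at_top)
  then obtain d where d: "c * (A + d) powr \<alpha> \<le> d" "d > 0"
    using eventually_happens[of _ "at_top :: real filter"] by auto
  show ?thesis
  proof (rule exI[of _ D], intro conjI D(1) exI[of _ d] allI impI d(2))
    fix n :: nat assume n: "n \<ge> 2"
    define x where "x = n * log 2 n"
    define y where "y = x powr (\<alpha> / (1 - \<alpha>))"
    define \<delta> where "\<delta> = D * 2 powr (- (d * y))"
    define m where "m = nat \<lfloor>(A + d) * (x * y)\<rfloor>"
    have L: "log 2 n \<ge> 1" using n by (simp add: le_log_iff)
    have x: "n \<le> x" using L n by (simp add: x_def)
    have y: "y \<ge> 1" unfolding y_def using x n \<alpha> by (intro ge_one_powr_ge_zero) auto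
    have xy: "x \<le> x * y" using x y n by simp
    have \<delta>: "\<delta> > 0" using D by (simp add: \<delta>_def)
    \<comment> \<open>This identity determines the exponent \<open>\<alpha> / (1 - \<alpha>)\<close> of the conclusion.\<close>
    have xya: "(x * y) powr \<alpha> = y"
    proof -
      have "x * y = x powr (1 + \<alpha> / (1 - \<alpha>))" using x n by (simp add: y_def powr_add)
      also have "1 + \<alpha> / (1 - \<alpha>) = 1 / (1 - \<alpha>)" using \<alpha> by (simp add: field_simps)
      finally show ?thesis by (simp add: powr_powr y_def)
    qed
    have big: "(A + d) * (x * y) \<ge> 1"
      using mult_mono[of 1 "A + d" 1 "x * y"] A d xy x n by simp
    then have m: "real m \<le> (A + d) * (x * y)" "(A + d) * (x * y) - 1 \<le> m" "m \<ge> 1"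
      by (simp_all add: m_def) linarith+
    have "n * log 2 (1 / \<delta>) = n * log 2 (1 / D) + d * (n * y)"
      using D by (simp add: \<delta>_def log_divide log_mult algebra_simps)
    also have "\<dots> \<le> x * log 2 (1 / D) + d * (x * y)"
      using x y lD d by (intro add_mono mult_right_mono mult_left_mono) auto
    finally have "(a + 4) * x + n * log 2 (1 / \<delta>) \<le> (A - 1) * x + d * (x * y)"
      by (simp add: A_def algebra_simps)
    also have "\<dots> \<le> (A - 1) * (x * y) + d * (x * y)"
      using mult_left_mono[OF xy, of "A - 1"] A by simp
    also have "\<dots> = (A + d) * (x * y) - x * y" by (simp add: algebra_simps)
    also have "\<dots> \<le> m" using m(2) xy x n by linarith
    finally have req: "(a + 4) * (n * log 2 n) + n * log 2 (1 / \<delta>) \<le> real m"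
      by (simp add: x_def)
    have "m powr \<alpha> \<le> ((A + d) * (x * y)) powr \<alpha>" using m \<alpha> by (intro powr_mono2) auto
    also have "\<dots> = (A + d) powr \<alpha> * y"
      using A d xy x n by (subst powr_mult) (auto simp: xya)
    finally have "c * m powr \<alpha> \<le> (c * (A + d) powr \<alpha>) * y" using c by simp
    also have "\<dots> \<le> d * y" using d y by (intro mult_right_mono) auto
    finally have exponent: "c * m powr \<alpha> \<le> d * y" .
    have "2 * \<delta> < C * 2 powr (- (d * y))" using D by (simp add: \<delta>_def)
    also have "\<dots> \<le> C * 2 powr (- (c * m powr \<alpha>))"
      using exponent C by (intro mult_left_mono powr_mono) auto
    also have "\<dots> \<le> entropy_number m K" using e m(3) by simp
    finally have "2 * \<delta> < entropy_number m K" .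
    from width_ge_of_entropy_number[OF K n \<delta> req this]
    show "kolmogorov_width (n - 1) K (real n powr (a * real n))
           \<ge> ereal (D * 2 powr (- (d * (real n * log 2 (real n)) powr (\<alpha> / (1 - \<alpha>)))))"
      by (simp add: \<delta>_def y_def x_def)
  qed
qed

theorem corollary4p5:
  fixes K :: "'h::{real_inner, complete_space} set" and a :: real
  assumes "compact K"
    and "(SUP f\<in>K. norm f) = 1"
    and "a > 0"
  shows
    "(\<forall>\<alpha> \<beta> C :: real. \<alpha> > 0 \<longrightarrow> C > 0 \<longrightarrow>
        (\<forall>n\<ge>2. entropy_number n K \<ge> C * (log 2 (real n) powr \<beta> / real n powr \<alpha>)) \<longrightarrow>
        (\<exists>C''>0. \<forall>n\<ge>2. kolmogorov_width (n - 1) K (real n powr (a * real n))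
            \<ge> ereal (C'' * (log 2 (real n) powr (\<beta> - 2 * \<alpha>) / real n powr \<alpha>))))
     \<and> (\<forall>\<alpha> C :: real. \<alpha> > 0 \<longrightarrow> C > 0 \<longrightarrow>
        (\<forall>n\<ge>2. entropy_number n K \<ge> C * (1 / log 2 (real n) powr \<alpha>)) \<longrightarrow>
        (\<exists>C''>0. \<forall>n\<ge>2. kolmogorov_width (n - 1) K (real n powr (a * real n))
            \<ge> ereal (C'' * (1 / log 2 (real n) powr \<alpha>))))
     \<and> (\<forall>\<alpha> C c :: real. 0 < \<alpha> \<longrightarrow> \<alpha> < 1 \<longrightarrow> C > 0 \<longrightarrow> c > 0 \<longrightarrow>
        (\<forall>n\<ge>1. entropy_number n K \<ge> C * 2 powr (- (c * real n powr \<alpha>))) \<longrightarrow>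
        (\<exists>C''>0. \<exists>c''>0. \<forall>n\<ge>2. kolmogorov_width (n - 1) K (real n powr (a * real n))
            \<ge> ereal (C'' * 2 powr (- (c'' * (real n * log 2 (real n)) powr (\<alpha> / (1 - \<alpha>)))))))"
proof -
  have K: "\<forall>f\<in>K. norm f \<le> 1"
  proof
    fix f assume f: "f \<in> K"
    have "bdd_above (norm ` K)"
      using compact_imp_bounded[OF assms(1)] by (auto simp: bounded_iff bdd_above_def)
    then show "norm f \<le> 1" using cSUP_upper[OF f, of norm] assms(2) by simp
  qed
  show ?thesis
  proof (intro conjI allI impI)
    fix \<alpha> \<beta> C :: real
    assume \<alpha>: "\<alpha> > 0" and C: "C > 0"
      and e: "\<forall>n\<ge>2. entropy_number n K \<ge> C * (log 2 (real n) powr \<beta> / real n powr \<alpha>)"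
    obtain D where D: "D > 0" and w: "\<And>n. n \<ge> 2 \<Longrightarrow> kolmogorov_width (n - 1) K (real n powr (a * real n))
        \<ge> ereal (D * (log 2 (real n) powr (\<beta> - \<alpha>) / real n powr \<alpha>))"
      using width_ge_polynomial[OF K assms(3) less_imp_le[OF \<alpha>] C e] by blast
    have le: "D * (log 2 (real n) powr (\<beta> - 2 * \<alpha>) / real n powr \<alpha>)
        \<le> D * (log 2 (real n) powr (\<beta> - \<alpha>) / real n powr \<alpha>)" if "n \<ge> 2" for n :: nat
    proof -
      have "log 2 n \<ge> 1" using that by (simp add: le_log_iff)
      then show ?thesis
        using D \<alpha> by (intro mult_left_mono divide_right_mono powr_mono) auto
    qed
    show "\<exists>C''>0. \<forall>n\<ge>2. kolmogorov_width (n - 1) K (real n powr (a * real n))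
        \<ge> ereal (C'' * (log 2 (real n) powr (\<beta> - 2 * \<alpha>) / real n powr \<alpha>))"
      using D w le by (meson ereal_less_eq(3) order_trans)
  next
    fix \<alpha> C :: real
    assume "\<alpha> > 0" and C: "C > 0"
      and e: "\<forall>n\<ge>2. entropy_number n K \<ge> C * (1 / log 2 (real n) powr \<alpha>)"
    have "\<forall>n\<ge>2. entropy_number n K \<ge> C * (log 2 (real n) powr (- \<alpha>) / real n powr 0)"
      using e by (auto simp: powr_minus_divide)
    from width_ge_polynomial[OF K assms(3) order_refl C this]
    obtain D where "D > 0" and w: "\<forall>n\<ge>2. kolmogorov_width (n - 1) K (real n powr (a * real n))
        \<ge> ereal (D * (log 2 (real n) powr (- \<alpha> - 0) / real n powr 0))"
      by blast
    moreover have "\<forall>n\<ge>2. kolmogorov_width (n - 1) K (real n powr (a * real n))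
        \<ge> ereal (D * (1 / log 2 (real n) powr \<alpha>))"
      using w by (auto simp: powr_minus_divide)
    ultimately show "\<exists>C''>0. \<forall>n\<ge>2. kolmogorov_width (n - 1) K (real n powr (a * real n))
        \<ge> ereal (C'' * (1 / log 2 (real n) powr \<alpha>))" by blast
  next
    fix \<alpha> C c :: real
    assume "0 < \<alpha>" "\<alpha> < 1" "C > 0" "c > 0"
      "\<forall>n\<ge>1. entropy_number n K \<ge> C * 2 powr (- (c * real n powr \<alpha>))"
    then show "\<exists>C''>0. \<exists>c''>0. \<forall>n\<ge>2. kolmogorov_width (n - 1) K (real n powr (a * real n))
        \<ge> ereal (C'' * 2 powr (- (c'' * (real n * log 2 (real n)) powr (\<alpha> / (1 - \<alpha>)))))"
      by (rule width_ge_exponential[OF K assms(3)])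
  qed
qed

end
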